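(* For every fixed integer $r\ge 2$, \textsc{D$r$DSR} under $\mathsf{TJ}$ on trees can be solved in linear time.
   Context: For an integer $r\ge1$, a distance-$r$ dominating set (D$r$DS) of a graph $G$ is a set $D\subseteq V(G)$ such that every vertex is at distance at most $r$ from some vertex of $D$. A $\mathsf{TJ}$-sequence between D$r$DSs $D_s,D_t$ is a sequence $D_s=D_0,\dots,D_q=D_t$ of D$r$DSs with $D_i\setminus D_{i+1}=\{x_i\}$ and $D_{i+1}\setminus D_i=\{y_i\}$ for each $i$. \textsc{D$r$DSR} under $\mathsf{TJ}$: given $G$ and D$r$DSs $D_s,D_t$, decide whether a $\mathsf{TJ}$-sequence between them exists. *)

theory Defs
  imports "Graph_Theory.Graph_Theory"
begin

section \<open>Distance-r dominating sets and token jumping\<close>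

text \<open>
  A finite simple undirected graph is a \<^locale>\<open>pair_graph\<close>: a finite, loop-free, symmetric set
  of arcs, each edge being represented by its two orientations.  Consequently every edge is a
  directed cycle of length 2, so that \<^const>\<open>tree\<close> does not describe undirected trees; the
  cycles of the undirected graph are the directed ones of length at least 3.  Connectedness
  entails that there is at least one vertex.
\<close>

definition undirected_tree :: "'a pair_pre_digraph \<Rightarrow> bool" where
  "undirected_tree G \<longleftrightarrow>
     pair_graph G \<and> Digraph_Component.connected (with_proj G) \<and>
     \<not> (\<exists>p. pre_digraph.cycle (with_proj G) p \<and> 3 \<le> length p)"

definition graph_dist :: "'a pair_pre_digraph \<Rightarrow> 'a \<Rightarrow> 'a \<Rightarrow> ereal" where
  "graph_dist G = wf_digraph.\<mu> (with_proj G) (\<lambda>_. 1)"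

definition distance_dominating_set :: "nat \<Rightarrow> 'a pair_pre_digraph \<Rightarrow> 'a set \<Rightarrow> bool" where
  "distance_dominating_set r G D \<longleftrightarrow>
     D \<subseteq> pverts G \<and> (\<forall>v\<in>pverts G. \<exists>u\<in>D. graph_dist G v u \<le> ereal (real r))"

definition TJ_sequence ::
  "nat \<Rightarrow> 'a pair_pre_digraph \<Rightarrow> 'a set \<Rightarrow> 'a set \<Rightarrow> nat \<Rightarrow> (nat \<Rightarrow> 'a set) \<Rightarrow> bool" where
  "TJ_sequence r G Ds Dt q D \<longleftrightarrow>
     D 0 = Ds \<and> D q = Dt \<and>
     (\<forall>i\<le>q. distance_dominating_set r G (D i)) \<and>
     (\<forall>i<q. \<exists>x y. D i - D (Suc i) = {x} \<and> D (Suc i) - D i = {y})"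

type_synonym 'a DrDSR_instance = "'a pair_pre_digraph \<times> 'a set \<times> 'a set"

definition DrDSR_tree_instances :: "nat \<Rightarrow> 'a DrDSR_instance set" where
  "DrDSR_tree_instances r =
     {(G, Ds, Dt). undirected_tree G \<and>
        distance_dominating_set r G Ds \<and> distance_dominating_set r G Dt}"

definition DrDSR_TJ :: "nat \<Rightarrow> 'a DrDSR_instance \<Rightarrow> bool" where
  "DrDSR_TJ r = (\<lambda>(G, Ds, Dt). \<exists>q D. TJ_sequence r G Ds Dt q D)"


section \<open>Random access machines\<close>

text \<open>
  A program has finitely many instructions and hence uses finitely many registers; the memory is
  reached by indirect addressing only.  Subtraction is truncated at 0.
\<close>

datatype instr =
    Const nat nat
  | Add nat nat nat
  | Sub nat nat nat
  | Load nat nat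
  | Store nat nat
  | Jump nat
  | JumpIfZero nat nat
  | Halt bool

record ram_config =
  pc :: nat
  regs :: "nat \<Rightarrow> nat"
  mem :: "nat \<Rightarrow> nat"

fun exec_instr :: "instr \<Rightarrow> ram_config \<Rightarrow> ram_config" where
  "exec_instr (Const i k) s = s\<lparr>pc := Suc (pc s), regs := (regs s)(i := k)\<rparr>"
| "exec_instr (Add i j k) s = s\<lparr>pc := Suc (pc s), regs := (regs s)(i := regs s j + regs s k)\<rparr>"
| "exec_instr (Sub i j k) s = s\<lparr>pc := Suc (pc s), regs := (regs s)(i := regs s j - regs s k)\<rparr>"
| "exec_instr (Load i j) s = s\<lparr>pc := Suc (pc s), regs := (regs s)(i := mem s (regs s j))\<rparr>"
| "exec_instr (Store i j) s = s\<lparr>pc := Suc (pc s), mem := (mem s)(regs s i := regs s j)\<rparr>"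
| "exec_instr (Jump l) s = s\<lparr>pc := l\<rparr>"
| "exec_instr (JumpIfZero i l) s = s\<lparr>pc := (if regs s i = 0 then l else Suc (pc s))\<rparr>"
| "exec_instr (Halt b) s = s"

definition ram_step :: "instr list \<Rightarrow> ram_config \<Rightarrow> ram_config" where
  "ram_step P s = (if pc s < length P then exec_instr (P ! pc s) s else s)"

definition ram_init :: "nat list \<Rightarrow> ram_config" where
  "ram_init w = \<lparr>pc = 0, regs = (\<lambda>_. 0)(0 := length w),
                 mem = (\<lambda>a. if a < length w then w ! a else 0)\<rparr>"

definition ram_config_at :: "instr list \<Rightarrow> nat list \<Rightarrow> nat \<Rightarrow> ram_config" where
  "ram_config_at P w t = (ram_step P ^^ t) (ram_init w)"

definition ram_answers :: "instr list \<Rightarrow> ram_config \<Rightarrow> bool \<Rightarrow> bool" where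
  "ram_answers P s b \<longleftrightarrow> pc s < length P \<and> P ! pc s = Halt b"

definition words_bounded :: "nat \<Rightarrow> ram_config \<Rightarrow> bool" where
  "words_bounded B s \<longleftrightarrow> (\<forall>i. regs s i \<le> B) \<and> (\<forall>a. mem s a \<le> B)"

text \<open>
  Linear time on a word RAM for the decision problem \<open>Q\<close> on the instances \<open>I\<close>: a single program
  answers correctly on every encoding \<open>w\<close> of every instance, within \<open>c * length w\<close> unit-cost steps,
  all words being of \<open>O(log (length w))\<close> bits, that is, of polynomially bounded value, throughout
  the computation.
\<close>

definition solvable_in_linear_time ::
  "('i \<Rightarrow> nat list \<Rightarrow> bool) \<Rightarrow> 'i set \<Rightarrow> ('i \<Rightarrow> bool) \<Rightarrow> bool" where
  "solvable_in_linear_time enc I Q \<longleftrightarrow>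
     (\<exists>P c d. \<forall>x\<in>I. \<forall>w. enc x w \<longrightarrow>
        (\<exists>t \<le> c * length w.
           ram_answers P (ram_config_at P w t) (Q x) \<and>
           (\<forall>s\<le>t. words_bounded (d * length w ^ d) (ram_config_at P w s))))"

text \<open>
  The vertices are numbered by an arbitrary enumeration \<open>vs\<close>.  The code consists of the number of
  vertices, the adjacency lists (each in arbitrary order and preceded by its length) and the
  characteristic vectors of the two sets.  Its length is \<open>1 + 3 |V| + 2 |E|\<close>, which is linear
  in \<open>|V| + |E|\<close>.
\<close>

definition encodes_DrDSR :: "'a DrDSR_instance \<Rightarrow> nat list \<Rightarrow> bool" where
  "encodes_DrDSR = (\<lambda>(G, Ds, Dt) w. \<exists>vs adj.
     distinct vs \<and> set vs = pverts G \<and>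
     (\<forall>i<length vs. distinct (adj i) \<and>
        set (adj i) = {j. j < length vs \<and> (vs ! i, vs ! j) \<in> parcs G}) \<and>
     w = [length vs]
       @ concat (map (\<lambda>i. length (adj i) # adj i) [0..<length vs])
       @ map (\<lambda>v. of_bool (v \<in> Ds)) vs
       @ map (\<lambda>v. of_bool (v \<in> Dt)) vs)"

end

theory Submission
  imports Defs
begin

text \<open>
  On a tree the answer is yes if and only if \<open>|Ds| = |Dt|\<close>, so that it suffices to sum up the two
  characteristic vectors.  Root the tree and build a dominating set \<open>C\<close> greedily, adding the \<open>r\<close>-th
  ancestor \<open>c\<close> of a deepest vertex \<open>v\<close> not yet dominated (or the root, if \<open>v\<close> has depth less than
  \<open>r\<close>).  If \<open>D\<close> contains the part of \<open>C\<close> built so far, then a token \<open>x\<close> of \<open>D\<close> that dominates \<open>v\<close>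
  may jump to \<open>c\<close>: for a vertex \<open>w\<close> that only \<open>x\<close> dominates, \<open>c\<close> lies on the path from \<open>w\<close> to the root
  or on the path from \<open>w\<close> to \<open>v\<close>, and \<open>w\<close> is at most as deep as \<open>v\<close> and within \<open>2r\<close> of \<open>v\<close>, so either
  way its distance to \<open>c\<close> is at most \<open>r\<close>.  Hence every dominating set reaches a superset of \<open>C\<close>, and
  the tokens outside \<open>C\<close> may jump freely.
\<close>

subsection \<open>Distances in trees\<close>

locale pair_tree = pair_graph +
  assumes connected_G: "Digraph_Component.connected (with_proj G)"
    and acyclic_G: "\<not> (cycle p \<and> 3 \<le> length p)"
begin

text \<open>A natural-number stand-in for the extended real \<open>graph_dist\<close>, so that the
  tree argument is plain arithmetic; \<open>graph_dist_le_iff\<close> connects the two. It is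
  meaningful between vertices of \<open>G\<close>, where connectedness supplies a walk.\<close>

definition wdist :: "'a \<Rightarrow> 'a \<Rightarrow> nat" where
  "wdist u v = (LEAST n. \<exists>p. awalk u p v \<and> length p = n)"

lemma verts_nonempty: "pverts G \<noteq> {}"
  using connected_G by (simp add: connected_conv)

lemma ex_awalk:
  assumes "u \<in> pverts G" "v \<in> pverts G"
  shows "\<exists>p. awalk u p v"
  using symmetric_connected_imp_strongly_connected[OF pair_sym_arcs connected_G] assms
  by (simp add: strongly_connected_def reachable_awalk)

lemma shortest_awalk:
  assumes "u \<in> pverts G" "v \<in> pverts G"
  obtains p where "awalk u p v" "length p = wdist u v"
proof -
  have "\<exists>n p. awalk u p v \<and> length p = n"
    using ex_awalk[OF assms] by blast
  then have "\<exists>p. awalk u p v \<and> length p = wdist u v"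
    unfolding wdist_def by (rule LeastI_ex)
  then show thesis using that by blast
qed

lemma wdist_le_length: "awalk u p v \<Longrightarrow> wdist u v \<le> length p"
  unfolding wdist_def by (rule Least_le) blast

lemma wdist_self: "u \<in> pverts G \<Longrightarrow> wdist u u = 0"
  using wdist_le_length[of u "[]" u] by (simp add: awalk_Nil_iff)

lemma arc_sym: "(u, v) \<in> parcs G \<Longrightarrow> (v, u) \<in> parcs G"
  using pair_sym_arcs by (simp add: symmetric_def sym_def)

lemma awalk_reverse:
  assumes "awalk u p v"
  shows "\<exists>q. awalk v q u \<and> length q = length p"
  using assms
proof (induction p arbitrary: u)
  case Nil
  then show ?case by (auto simp: awalk_Nil_iff)
next
  case (Cons e p)
  then have e: "e \<in> parcs G" "fst e = u" "awalk (snd e) p v"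
    by (auto simp: awalk_Cons_iff)
  then obtain q where q: "awalk v q (snd e)" "length q = length p"
    using Cons.IH by blast
  have "(snd e, u) \<in> parcs G"
    using e arc_sym by (metis prod.collapse)
  then have "awalk (snd e) [(snd e, u)] u"
    by (auto simp: awalk_Cons_iff awalk_Nil_iff dest: in_arcsD1 in_arcsD2)
  then have "awalk v (q @ [(snd e, u)]) u"
    using q(1) by (rule awalk_appendI[rotated])
  then show ?case using q(2) by (metis length_append_singleton length_Cons)
qed

lemma wdist_commute:
  assumes "u \<in> pverts G" "v \<in> pverts G"
  shows "wdist u v = wdist v u"
proof -
  have "wdist y x \<le> wdist x y" if "x \<in> pverts G" "y \<in> pverts G" for x y
    using shortest_awalk[OF that] awalk_reverse wdist_le_length by metis
  then show ?thesis using assms by (simp add: le_antisym)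
qed

lemma wdist_triangle:
  assumes "u \<in> pverts G" "v \<in> pverts G" "w \<in> pverts G"
  shows "wdist u w \<le> wdist u v + wdist v w"
proof -
  obtain p where p: "awalk u p v" "length p = wdist u v"
    using shortest_awalk assms by metis
  obtain q where q: "awalk v q w" "length q = wdist v w"
    using shortest_awalk assms by metis
  have "awalk u (p @ q) w" using p(1) q(1) by (rule awalk_appendI)
  from wdist_le_length[OF this] show ?thesis using p q by simp
qed

section \<open>Geodesics and separation by a vertex\<close>

lemma wdist_via_shortest:
  assumes "awalk u p v" "length p = wdist u v" "c \<in> set (pawalk_verts u p)"
  shows "wdist u c + wdist c v \<le> wdist u v"
proof -
  obtain q s where "p = q @ s" "awalk u q c" "awalk c s v"
    using awalk_decomp[OF assms(1,3)] by blast
  then show ?thesis using wdist_le_length[of u q c] wdist_le_length[of c s v] assms(2) by simp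
qed

text \<open>On vertices other than \<open>c\<close>, the reflexive transitive closure is the
  relation of lying in the same component of the tree with \<open>c\<close> deleted.\<close>

definition avoiding :: "'a \<Rightarrow> ('a \<times> 'a) set" where
  "avoiding c = {(x, y) \<in> parcs G. x \<noteq> c \<and> y \<noteq> c}"

lemma avoiding_sym: "(x, y) \<in> (avoiding c)\<^sup>* \<Longrightarrow> (y, x) \<in> (avoiding c)\<^sup>*"
proof -
  have "sym (avoiding c)" by (auto simp: avoiding_def sym_def arc_sym)
  then show "(x, y) \<in> (avoiding c)\<^sup>* \<Longrightarrow> (y, x) \<in> (avoiding c)\<^sup>*"
    using sym_rtrancl by (metis symD)
qed

lemma avoiding_awalk:
  assumes "awalk u p v" "c \<notin> set (pawalk_verts u p)"
  shows "(u, v) \<in> (avoiding c)\<^sup>*"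
  using assms
proof (induction p arbitrary: u)
  case Nil
  then show ?case by (simp add: awalk_Nil_iff)
next
  case (Cons e p)
  then have e: "e \<in> parcs G" "fst e = u" "awalk (snd e) p v" "u \<noteq> c"
      "c \<notin> set (pawalk_verts (snd e) p)"
    by (auto simp: awalk_Cons_iff)
  moreover have "snd e \<in> set (pawalk_verts (snd e) p)"
    using hd_in_awalk_verts(1)[OF e(3)] .
  ultimately have "(u, snd e) \<in> avoiding c"
    by (auto simp: avoiding_def)
  then show ?case using Cons.IH[OF e(3,5)] by (rule converse_rtrancl_into_rtrancl)
qed

lemma awalk_of_avoiding:
  assumes "(u, v) \<in> (avoiding c)\<^sup>*" "v \<in> pverts G" "v \<noteq> c"
  shows "\<exists>p. awalk u p v \<and> c \<notin> set (pawalk_verts u p)"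
  using assms(1)
proof (induction rule: converse_rtrancl_induct)
  case base
  then show ?case using assms by (intro exI[of _ "[]"]) (simp add: awalk_Nil_iff)
next
  case (step x y)
  then obtain p where "awalk y p v" "c \<notin> set (pawalk_verts y p)" by blast
  then show ?case using step.hyps(1)
    by (intro exI[of _ "(x, y) # p"]) (auto simp: awalk_Cons_iff avoiding_def)
qed

text \<open>Acyclicity enters here: a walk from \<open>a\<close> to \<open>b\<close> that misses
  \<open>c\<close> would close up through \<open>c\<close> to a cycle.\<close>

lemma neighbours_separated:
  assumes "(c, a) \<in> parcs G" "(c, b) \<in> parcs G" "a \<noteq> b"
  shows "(a, b) \<notin> (avoiding c)\<^sup>*"
proof
  assume "(a, b) \<in> (avoiding c)\<^sup>*"
  moreover have "b \<in> pverts G" "b \<noteq> c"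
    using assms in_arcsD2 pair_no_loops by fastforce+
  ultimately obtain p where p: "awalk a p b" "c \<notin> set (pawalk_verts a p)"
    using awalk_of_avoiding by blast
  \<comment> \<open>Loops are cut out so that the closed walk repeats no vertex; the path only
    visits vertices of \<open>p\<close> and hence still misses \<open>c\<close>.\<close>
  define q where "q = awalk_to_apath p"
  have q: "apath a q b" unfolding q_def by (rule apath_awalk_to_apath[OF p(1)])
  then have qw: "awalk a q b" by (rule awalkI_apath)
  have "set (pawalk_verts a q) \<subseteq> set (pawalk_verts a p)"
    using set_awalk_verts[OF p(1)] set_awalk_verts[OF qw] awalk_to_apath_subset[OF p(1)]
    by (auto simp: q_def)
  then have c: "c \<notin> set (pawalk_verts a q)" using p(2) by blast
  have "q \<noteq> []" using qw assms(3) by (auto simp: awalk_Nil_iff)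
  have bc: "awalk b [(b, c)] c"
    using arc_sym[OF assms(2)] by (auto simp: awalk_Cons_iff awalk_Nil_iff dest: in_arcsD1 in_arcsD2)
  have abc: "awalk a (q @ [(b, c)]) c" by (rule awalk_appendI[OF qw bc])
  then have w: "awalk c ((c, a) # q @ [(b, c)]) c"
    using assms(1) qw bc by (auto simp: awalk_Cons_iff)
  have "pawalk_verts a (q @ [(b, c)]) = pawalk_verts a q @ [c]"
    using awalk_verts_append[OF abc] awlast_of_awalk[OF qw] by simp
  then have "distinct (tl (pawalk_verts c ((c, a) # q @ [(b, c)])))"
    using q c by (simp add: apath_def)
  then have "cycle ((c, a) # q @ [(b, c)])"
    using w unfolding cycle_def by blast
  \<comment> \<open>The path \<open>q\<close> is nonempty because \<open>a\<close> and
    \<open>b\<close> differ, which rules out the directed 2-cycle formed by a single edge.\<close>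
  moreover have "3 \<le> length ((c, a) # q @ [(b, c)])"
    using \<open>q \<noteq> []\<close> by (cases q) auto
  ultimately show False using acyclic_G by blast
qed

text \<open>Take the first arc of a shortest walk. The rest never returns to \<open>c\<close>, as
  otherwise its suffix from \<open>c\<close> would be shorter still.\<close>

lemma first_step:
  assumes "c \<in> pverts G" "v \<in> pverts G" "c \<noteq> v"
  obtains a where "(c, a) \<in> parcs G" "Suc (wdist a v) \<le> wdist c v" "(a, v) \<in> (avoiding c)\<^sup>*"
proof -
  obtain p where p: "awalk c p v" "length p = wdist c v"
    using shortest_awalk assms by metis
  then obtain e p' where pe: "p = e # p'"
    using assms(3) by (cases p) (auto simp: awalk_Nil_iff)
  then have e: "(c, snd e) \<in> parcs G" "awalk (snd e) p' v"
    using p(1) by (auto simp: awalk_Cons_iff)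
  have "c \<notin> set (pawalk_verts (snd e) p')"
  proof
    assume "c \<in> set (pawalk_verts (snd e) p')"
    then obtain q s where "p' = q @ s" "awalk c s v"
      using awalk_decomp[OF e(2)] by blast
    then have "wdist c v \<le> length p'" using wdist_le_length[of c s v] by simp
    then show False using p(2) pe by simp
  qed
  then have "(snd e, v) \<in> (avoiding c)\<^sup>*" using avoiding_awalk e(2) by blast
  moreover have "Suc (wdist (snd e) v) \<le> wdist c v"
    using wdist_le_length[OF e(2)] p(2) pe by simp
  ultimately show thesis using that e(1) by blast
qed

text \<open>If both alternatives failed, shortest walks from \<open>w\<close> to \<open>u\<close>
  and to \<open>v\<close> would miss \<open>c\<close>, putting \<open>u\<close> and \<open>v\<close>
  in one component after deleting \<open>c\<close>. But the geodesic from \<open>u\<close> to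
  \<open>v\<close> meets \<open>c\<close> through two different neighbours, which
  \<open>neighbours_separated\<close> keeps apart.\<close>

lemma geodesic_vertex_separates:
  assumes V: "u \<in> pverts G" "c \<in> pverts G" "v \<in> pverts G" "w \<in> pverts G"
    and geo: "wdist u c + wdist c v = wdist u v"
  shows "wdist w c + wdist c u \<le> wdist w u \<or> wdist w c + wdist c v \<le> wdist w v"
proof (rule ccontr)
  assume neg: "\<not> ?thesis"
  then have "c \<noteq> u" "c \<noteq> v" using V wdist_self by auto
  obtain a where a: "(c, a) \<in> parcs G" "Suc (wdist a u) \<le> wdist c u" "(a, u) \<in> (avoiding c)\<^sup>*"
    using first_step[OF V(2,1) \<open>c \<noteq> u\<close>] by blast
  obtain b where b: "(c, b) \<in> parcs G" "Suc (wdist b v) \<le> wdist c v" "(b, v) \<in> (avoiding c)\<^sup>*"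
    using first_step[OF V(2,3) \<open>c \<noteq> v\<close>] by blast
  have aV: "a \<in> pverts G" using a(1) in_arcsD2 by blast
  \<comment> \<open>A common neighbour would give a walk from \<open>u\<close> to \<open>v\<close>
    shorter by 2 than the geodesic through \<open>c\<close>.\<close>
  have "a \<noteq> b"
    using a(2) b(2) geo wdist_triangle[OF V(1) aV V(3)] wdist_commute[OF V(1) aV]
      wdist_commute[OF V(1,2)] by auto
  have avoid: "(w, x) \<in> (avoiding c)\<^sup>*"
    if "x \<in> pverts G" "\<not> wdist w c + wdist c x \<le> wdist w x" for x
    using shortest_awalk[OF V(4) that(1)] wdist_via_shortest avoiding_awalk that(2) by metis
  have "(w, u) \<in> (avoiding c)\<^sup>*" "(w, v) \<in> (avoiding c)\<^sup>*"
    using avoid V neg by auto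
  then have "(a, b) \<in> (avoiding c)\<^sup>*"
    using a(3) b(3) avoiding_sym by (meson rtrancl_trans)
  then show False using neighbours_separated[OF a(1) b(1) \<open>a \<noteq> b\<close>] by blast
qed

section \<open>The replacement vertex for a deepest vertex\<close>

lemma geodesic_vertex_at:
  assumes "u \<in> pverts G" "v \<in> pverts G" "k \<le> wdist u v"
  obtains c where "c \<in> pverts G" "wdist u c + wdist c v = wdist u v" "wdist c v = k"
proof -
  obtain p where p: "awalk u p v" "length p = wdist u v"
    using shortest_awalk assms by metis
  define m where "m = wdist u v - k"
  have "awalk u (take m p @ drop m p) v" using p by simp
  then obtain c where c: "awalk u (take m p) c" "awalk c (drop m p) v"
    unfolding awalk_append_iff by blast
  then have cV: "c \<in> pverts G" using awalk_hd_in_verts by blast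
  have "wdist u c \<le> m" "wdist c v \<le> k"
    using wdist_le_length[OF c(1)] wdist_le_length[OF c(2)] p(2) assms(3) by (auto simp: m_def)
  then show thesis
    using that[OF cV] wdist_triangle[OF assms(1) cV assms(2)] assms(3) by (auto simp: m_def)
qed

text \<open>The vertex \<open>c\<close> is fixed before \<open>x\<close> and \<open>w\<close>, so
  one replacement serves every token that may dominate \<open>v\<close>. It is the root \<rho> if
  \<open>v\<close> has depth at most \<open>r\<close>, and the \<open>r\<close>-th ancestor of
  \<open>v\<close> otherwise.\<close>

lemma deepest_vertex_exchange:
  assumes "\<rho> \<in> pverts G" "v \<in> pverts G"
  obtains c where "c \<in> pverts G" "wdist c v \<le> r"
    "\<And>x w. x \<in> pverts G \<Longrightarrow> w \<in> pverts G \<Longrightarrow> wdist v x \<le> r \<Longrightarrow> wdist w x \<le> r \<Longrightarrow>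
       wdist \<rho> w \<le> wdist \<rho> v \<Longrightarrow> wdist w c \<le> r"
proof (cases "wdist \<rho> v \<le> r")
  case True
  then show thesis using that[OF assms(1)] wdist_commute assms by fastforce
next
  case False
  then obtain c where c: "c \<in> pverts G" "wdist \<rho> c + wdist c v = wdist \<rho> v" "wdist c v = r"
    using geodesic_vertex_at[OF assms, of r] by auto
  show thesis
  proof (rule that)
    fix x w assume xw: "x \<in> pverts G" "w \<in> pverts G" "wdist v x \<le> r" "wdist w x \<le> r"
      "wdist \<rho> w \<le> wdist \<rho> v"
    have "wdist w v \<le> r + r"
      using wdist_triangle[of w x v] wdist_commute[of v x] xw assms by simp
    \<comment> \<open>If \<open>c\<close> lies between \<open>w\<close> and \<rho>, the distance is
      the depth of \<open>w\<close> minus that of \<open>c\<close>, at most the depth of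
      \<open>v\<close> minus that of \<open>c\<close>, which is \<open>r\<close>. If
      \<open>c\<close> lies between \<open>w\<close> and \<open>v\<close>, it is at most
      \<open>2r - r\<close>.\<close>
    then show "wdist w c \<le> r"
      using geodesic_vertex_separates[OF assms(1) c(1) assms(2) xw(2) c(2)]
        wdist_commute[OF assms(1) c(1)] wdist_commute[OF assms(1) xw(2)] c xw(5) by auto
  qed (use c in auto)
qed

lemma graph_dist_le_iff:
  assumes "u \<in> pverts G" "v \<in> pverts G"
  shows "graph_dist G u v \<le> ereal (real n) \<longleftrightarrow> wdist u v \<le> n"
proof -
  have cost: "awalk_cost (\<lambda>_. 1) p = real (length p)" for p
    by (simp add: awalk_cost_def sum_list_triv)
  show ?thesis
  proof
    assume "graph_dist G u v \<le> ereal (real n)"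
    \<comment> \<open>A strict bound is what extracts a walk from the infimum; lengths being
      integers, \<open>Suc n\<close> loses nothing.\<close>
    then have "graph_dist G u v < ereal (real (Suc n))"
      by (rule le_less_trans) simp
    then obtain p where "awalk u p v" "length p < Suc n"
      unfolding graph_dist_def \<mu>_def INF_less_iff cost by auto
    then show "wdist u v \<le> n" using wdist_le_length by fastforce
  next
    assume "wdist u v \<le> n"
    moreover obtain p where "awalk u p v" "length p = wdist u v"
      using shortest_awalk assms by metis
    ultimately show "graph_dist G u v \<le> ereal (real n)"
      using min_cost_le_walk_cost[of u p v "\<lambda>_. 1"] unfolding graph_dist_def cost
      by (smt (verit) ereal_less_eq(3) of_nat_le_iff order_trans)
  qed
qed

end

subsection \<open>Token jumping on trees\<close>

definition TJ_step :: "nat \<Rightarrow> 'a pair_pre_digraph \<Rightarrow> 'a set \<Rightarrow> 'a set \<Rightarrow> bool" where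
  "TJ_step r G A B \<longleftrightarrow> distance_dominating_set r G A \<and> distance_dominating_set r G B \<and>
     (\<exists>x y. A - B = {x} \<and> B - A = {y})"

lemma TJ_reachable_sym:
  assumes "(TJ_step r G)\<^sup>*\<^sup>* A B"
  shows "(TJ_step r G)\<^sup>*\<^sup>* B A"
proof -
  have "symp (TJ_step r G)" by (auto simp: TJ_step_def symp_def)
  then show ?thesis using assms by (metis symp_rtranclp sympD)
qed

lemma TJ_reachable_if_TJ_sequence:
  assumes "TJ_sequence r G Ds Dt q D"
  shows "(TJ_step r G)\<^sup>*\<^sup>* Ds Dt"
proof -
  have "(TJ_step r G)\<^sup>*\<^sup>* Ds (D i)" if "i \<le> q" for i
    using that
  proof (induction i)
    case 0
    then show ?case using assms by (simp add: TJ_sequence_def)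
  next
    case (Suc i)
    then have "TJ_step r G (D i) (D (Suc i))"
      using assms by (auto simp: TJ_sequence_def TJ_step_def)
    then show ?case using Suc by (auto intro: rtranclp.rtrancl_into_rtrancl)
  qed
  then show ?thesis using assms by (auto simp: TJ_sequence_def)
qed

text \<open>The reflexive closure relates every set to itself, whereas a sequence of length 0 must
  consist of a dominating set; hence the second hypothesis.\<close>

lemma TJ_sequence_if_TJ_reachable:
  assumes "(TJ_step r G)\<^sup>*\<^sup>* Ds Dt" "distance_dominating_set r G Ds"
  shows "\<exists>q D. TJ_sequence r G Ds Dt q D"
  using assms(1)
proof (induction rule: rtranclp_induct)
  case base
  have "TJ_sequence r G Ds Ds 0 (\<lambda>_. Ds)" using assms(2) by (simp add: TJ_sequence_def)
  then show ?case by blast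
next
  case (step A B)
  then obtain q D where D: "TJ_sequence r G Ds A q D" by blast
  have "TJ_sequence r G Ds B (Suc q) (D(Suc q := B))"
    using D step.hyps(2) by (auto simp: TJ_sequence_def TJ_step_def le_Suc_eq less_Suc_eq)
  then show ?case by blast
qed

lemma distance_dominating_set_mono:
  assumes "distance_dominating_set r G C" "C \<subseteq> D" "D \<subseteq> pverts G"
  shows "distance_dominating_set r G D"
  using assms by (fastforce simp: distance_dominating_set_def)

lemma TJ_reachable_card_eq:
  assumes "(TJ_step r G)\<^sup>*\<^sup>* A B" "finite (pverts G)"
  shows "card A = card B"
  using assms(1)
proof (induction rule: rtranclp_induct)
  case (step B C)
  then obtain x y where xy: "B - C = {x}" "C - B = {y}" and "finite B" "finite C"
    using assms(2) by (auto simp: TJ_step_def distance_dominating_set_def intro: finite_subset)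
  then have "card B = card (B \<inter> C) + card {x}" "card C = card (B \<inter> C) + card {y}"
    by (metis card_Int_Diff, metis card_Int_Diff inf_commute)
  then show ?case using step.IH by simp
qed simp

text \<open>The tokens on \<open>C\<close> stay put and already dominate, so any token of
  \<open>A - B\<close> may jump to any vertex of \<open>B - A\<close>; each such jump shrinks
  \<open>A - B\<close>.\<close>

lemma TJ_reachable_supersets:
  assumes "distance_dominating_set r G C" "C \<subseteq> A" "C \<subseteq> B" "A \<subseteq> pverts G" "B \<subseteq> pverts G"
    "card A = card B" "finite (pverts G)"
  shows "(TJ_step r G)\<^sup>*\<^sup>* A B"
  using assms(2,4,6)
proof (induction "card (A - B)" arbitrary: A rule: less_induct)
  case less
  have fin: "finite A" "finite B"
    using less.prems assms(5,7) by (auto intro: finite_subset)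
  show ?case
  proof (cases "A \<subseteq> B")
    case True
    then have "A = B" using fin less.prems by (simp add: card_subset_eq)
    then show ?thesis by simp
  next
    case False
    then obtain x where x: "x \<in> A" "x \<notin> B" by blast
    then have "\<not> B \<subseteq> A" using fin less.prems by (metis card_subset_eq)
    then obtain y where y: "y \<in> B" "y \<notin> A" by blast
    let ?A = "insert y (A - {x})"
    have A': "C \<subseteq> ?A" "?A \<subseteq> pverts G" "card ?A = card B"
      using x y less.prems assms(3,5) fin card_Suc_Diff1[of A x] by auto
    have "A - ?A = {x}" "?A - A = {y}" using x y by auto
    moreover have "distance_dominating_set r G A" "distance_dominating_set r G ?A"
      using distance_dominating_set_mono[OF assms(1)] A' less.prems by simp_all
    ultimately have "TJ_step r G A ?A" by (simp add: TJ_step_def)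
    moreover have "?A - B = (A - B) - {x}" using y by auto
    then have "card (?A - B) < card (A - B)"
      using fin x card_Diff1_less[of "A - B" x] by simp
    then have "(TJ_step r G)\<^sup>*\<^sup>* ?A B" using less.hyps A' by blast
    ultimately show ?thesis by (rule converse_rtranclp_into_rtranclp)
  qed
qed

section \<open>A common target for all dominating sets\<close>

context pair_tree
begin

lemma distance_dominating_set_iff:
  "distance_dominating_set r G D \<longleftrightarrow>
     D \<subseteq> pverts G \<and> (\<forall>v\<in>pverts G. \<exists>u\<in>D. wdist v u \<le> r)"
  unfolding distance_dominating_set_def using graph_dist_le_iff by (metis subsetD)

text \<open>One greedy step, with \<open>c\<close> chosen from \<open>C\<close> alone so that it
  works for all \<open>D\<close> simultaneously; each \<open>D\<close> needs at most one
  jump.\<close>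

lemma extend_common_target:
  assumes C: "C \<subseteq> pverts G" "\<not> distance_dominating_set r G C"
  obtains c where "c \<in> pverts G - C"
    "\<And>D. distance_dominating_set r G D \<Longrightarrow> C \<subseteq> D \<Longrightarrow>
       \<exists>D'. (TJ_step r G)\<^sup>*\<^sup>* D D' \<and> distance_dominating_set r G D' \<and> insert c C \<subseteq> D'"
proof -
  obtain \<rho> where \<rho>: "\<rho> \<in> pverts G" using verts_nonempty by blast
  define U where "U = {v \<in> pverts G. \<not> (\<exists>u\<in>C. wdist v u \<le> r)}"
  have U: "finite U" "U \<noteq> {}"
    using C pair_finite_verts by (auto simp: U_def distance_dominating_set_iff)
  then have "Max (wdist \<rho> ` U) \<in> wdist \<rho> ` U" by (intro Max_in) auto
  then obtain v where v: "v \<in> U" "wdist \<rho> v = Max (wdist \<rho> ` U)" by auto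
  have deepest: "wdist \<rho> w \<le> wdist \<rho> v" if "w \<in> U" for w
    using v(2) U(1) that by simp
  have vV: "v \<in> pverts G" using v(1) by (simp add: U_def)
  obtain c where c: "c \<in> pverts G" "wdist c v \<le> r"
    and exchange: "\<And>x w. x \<in> pverts G \<Longrightarrow> w \<in> pverts G \<Longrightarrow> wdist v x \<le> r \<Longrightarrow> wdist w x \<le> r \<Longrightarrow>
       wdist \<rho> w \<le> wdist \<rho> v \<Longrightarrow> wdist w c \<le> r"
    using deepest_vertex_exchange[OF \<rho> vV] by blast
  show thesis
  proof (rule that)
    \<comment> \<open>\<open>c\<close> is within \<open>r\<close> of \<open>v\<close>, which no
      vertex of \<open>C\<close> is.\<close>
    show "c \<in> pverts G - C"
      using c v(1) wdist_commute[OF c(1) vV] by (auto simp: U_def)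
  next
    fix D assume D: "distance_dominating_set r G D" "C \<subseteq> D"
    show "\<exists>D'. (TJ_step r G)\<^sup>*\<^sup>* D D' \<and> distance_dominating_set r G D' \<and> insert c C \<subseteq> D'"
    proof (cases "c \<in> D")
      case True
      then show ?thesis using D by blast
    next
      case False
      obtain x where x: "x \<in> D" "wdist v x \<le> r"
        using D(1) vV by (auto simp: distance_dominating_set_iff)
      then have xC: "x \<notin> C" using v(1) by (auto simp: U_def)
      let ?D = "insert c (D - {x})"
      have DV: "D \<subseteq> pverts G" using D(1) by (simp add: distance_dominating_set_iff)
      \<comment> \<open>Vertices outside \<open>U\<close> are dominated by \<open>C\<close>, which
        the jump leaves in place since \<open>x\<close> is not in \<open>C\<close>. Vertices in
        \<open>U\<close> are no deeper than \<open>v\<close>, so \<open>c\<close> takes over those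
        that \<open>x\<close> served.\<close>
      have "\<exists>u\<in>?D. wdist w u \<le> r" if w: "w \<in> pverts G" for w
      proof (cases "w \<in> U")
        case True
        obtain y where y: "y \<in> D" "wdist w y \<le> r"
          using D(1) w by (auto simp: distance_dominating_set_iff)
        then show ?thesis
          using exchange[of x w] x DV w deepest[OF True] by (cases "y = x") auto
      next
        case False
        then show ?thesis using w D(2) xC by (auto simp: U_def)
      qed
      then have D': "distance_dominating_set r G ?D"
        using DV c(1) by (auto simp: distance_dominating_set_iff)
      moreover have "D - ?D = {x}" "?D - D = {c}" using False x(1) by auto
      then have "TJ_step r G D ?D"
        unfolding TJ_step_def using D(1) D' by blast
      moreover have "insert c C \<subseteq> ?D" using D(2) xC by blast
      ultimately show ?thesis by blast
    qed
  qed
qed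

text \<open>A maximal set with the reachability property replaces the iteration of the greedy step:
  if it did not dominate, \<open>extend_common_target\<close> would enlarge it. The empty set
  qualifies trivially.\<close>

lemma common_target:
  obtains C where "distance_dominating_set r G C"
    "\<And>D. distance_dominating_set r G D \<Longrightarrow>
       \<exists>D'. (TJ_step r G)\<^sup>*\<^sup>* D D' \<and> distance_dominating_set r G D' \<and> C \<subseteq> D'"
proof -
  let ?P = "\<lambda>C. C \<subseteq> pverts G \<and> (\<forall>D. distance_dominating_set r G D \<longrightarrow>
       (\<exists>D'. (TJ_step r G)\<^sup>*\<^sup>* D D' \<and> distance_dominating_set r G D' \<and> C \<subseteq> D'))"
  have "finite (Collect ?P)"
    by (rule finite_subset[of _ "Pow (pverts G)"]) (auto simp: pair_finite_verts)
  moreover have "{} \<in> Collect ?P" by blast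
  ultimately have "\<exists>C\<in>Collect ?P. \<forall>C'\<in>Collect ?P. C \<subseteq> C' \<longrightarrow> C = C'"
    by (intro finite_has_maximal) (assumption, rule notI, simp only: empty_iff)
  then obtain C where C: "?P C" and "\<forall>C'\<in>Collect ?P. C \<subseteq> C' \<longrightarrow> C = C'"
    by (elim bexE CollectE)
  then have maximal: "C = C'" if "?P C'" "C \<subseteq> C'" for C'
    using that by simp
  have "distance_dominating_set r G C"
  proof (rule ccontr)
    assume "\<not> distance_dominating_set r G C"
    then obtain c where c: "c \<in> pverts G - C"
      and ext: "\<And>D. distance_dominating_set r G D \<Longrightarrow> C \<subseteq> D \<Longrightarrow>
        \<exists>D'. (TJ_step r G)\<^sup>*\<^sup>* D D' \<and> distance_dominating_set r G D' \<and> insert c C \<subseteq> D'"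
      using extend_common_target C by blast
    have "?P (insert c C)"
    proof (intro conjI allI impI)
      fix D assume "distance_dominating_set r G D"
      then obtain D1 where D1: "(TJ_step r G)\<^sup>*\<^sup>* D D1" "distance_dominating_set r G D1" "C \<subseteq> D1"
        using C by blast
      then obtain D2 where "(TJ_step r G)\<^sup>*\<^sup>* D1 D2" "distance_dominating_set r G D2"
          "insert c C \<subseteq> D2"
        using ext by blast
      then show "\<exists>D'. (TJ_step r G)\<^sup>*\<^sup>* D D' \<and> distance_dominating_set r G D' \<and> insert c C \<subseteq> D'"
        using D1(1) rtranclp_trans by metis
    qed (use c C in auto)
    then have "C = insert c C" by (rule maximal) (rule subset_insertI)
    then show False using c by blast
  qed
  then show thesis using that C by blast
qed

text \<open>Jumps preserve cardinality. Conversely, both sets reach supersets of the common target,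
  these reach each other, and the second route is reversed by symmetry.\<close>

lemma TJ_reachable_iff_card_eq:
  assumes "distance_dominating_set r G Ds" "distance_dominating_set r G Dt"
  shows "(TJ_step r G)\<^sup>*\<^sup>* Ds Dt \<longleftrightarrow> card Ds = card Dt"
proof
  assume "(TJ_step r G)\<^sup>*\<^sup>* Ds Dt"
  then show "card Ds = card Dt" using TJ_reachable_card_eq pair_finite_verts by blast
next
  assume eq: "card Ds = card Dt"
  obtain C where C: "distance_dominating_set r G C"
    "\<And>D. distance_dominating_set r G D \<Longrightarrow>
       \<exists>D'. (TJ_step r G)\<^sup>*\<^sup>* D D' \<and> distance_dominating_set r G D' \<and> C \<subseteq> D'"
    using common_target[of r] by blast
  obtain A where A: "(TJ_step r G)\<^sup>*\<^sup>* Ds A" "distance_dominating_set r G A" "C \<subseteq> A"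
    using C assms by blast
  obtain B where B: "(TJ_step r G)\<^sup>*\<^sup>* Dt B" "distance_dominating_set r G B" "C \<subseteq> B"
    using C assms by blast
  have "card A = card B"
    using TJ_reachable_card_eq[OF A(1)] TJ_reachable_card_eq[OF B(1)] eq pair_finite_verts by simp
  then have "(TJ_step r G)\<^sup>*\<^sup>* A B"
    using TJ_reachable_supersets[OF C(1) A(3) B(3)] A(2) B(2) pair_finite_verts
    by (simp add: distance_dominating_set_def)
  then show "(TJ_step r G)\<^sup>*\<^sup>* Ds Dt"
    using A(1) TJ_reachable_sym[OF B(1)] by (meson rtranclp_trans)
qed

end

lemma DrDSR_TJ_tree_iff:
  assumes "(G, Ds, Dt) \<in> DrDSR_tree_instances r"
  shows "DrDSR_TJ r (G, Ds, Dt) \<longleftrightarrow> card Ds = card Dt"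
proof -
  have t: "undirected_tree G" and d: "distance_dominating_set r G Ds" "distance_dominating_set r G Dt"
    using assms by (auto simp: DrDSR_tree_instances_def)
  interpret pair_graph G using t by (simp add: undirected_tree_def)
  interpret pair_tree G
    using t by unfold_locales (auto simp: undirected_tree_def)
  show ?thesis
    using TJ_reachable_iff_card_eq[OF d] TJ_sequence_if_TJ_reachable[of r G Ds Dt]
      TJ_reachable_if_TJ_sequence[of r G Ds Dt] d(1)
    by (auto simp: DrDSR_TJ_def)
qed

subsection \<open>The counting program\<close>

definition bounded_run :: "instr list \<Rightarrow> nat \<Rightarrow> ram_config \<Rightarrow> nat \<Rightarrow> ram_config \<Rightarrow> bool" where
  "bounded_run P B s t s' \<longleftrightarrow>
     (ram_step P ^^ t) s = s' \<and> (\<forall>k\<le>t. words_bounded B ((ram_step P ^^ k) s))"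

lemma bounded_run_0: "bounded_run P B s 0 s' \<longleftrightarrow> words_bounded B s \<and> s = s'"
  by (auto simp: bounded_run_def)

lemma bounded_run_Suc:
  "bounded_run P B s (Suc t) s' \<longleftrightarrow> words_bounded B s \<and> bounded_run P B (ram_step P s) t s'"
proof -
  have "(\<forall>k\<le>Suc t. Q k) \<longleftrightarrow> Q 0 \<and> (\<forall>k\<le>t. Q (Suc k))" for Q
    by (metis Suc_le_mono le0 not0_implies_Suc)
  then show ?thesis
    by (auto simp: bounded_run_def funpow_swap1)
qed

lemma bounded_run_numeral:
  "bounded_run P B s (numeral v) s' \<longleftrightarrow>
     words_bounded B s \<and> bounded_run P B (ram_step P s) (pred_numeral v) s'"
  by (simp add: numeral_eq_Suc bounded_run_Suc)

lemma bounded_run_trans: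
  assumes "bounded_run P B s t s'" "bounded_run P B s' t' s''"
  shows "bounded_run P B s (t + t') s''"
  using assms by (induction t arbitrary: s) (auto simp: bounded_run_0 bounded_run_Suc)

text \<open>Holding the registers in a finite list turns register updates into list updates and the
  word bound on registers into a finite check, so that the simplifier can run the program.\<close>

definition reg_config :: "nat \<Rightarrow> nat list \<Rightarrow> (nat \<Rightarrow> nat) \<Rightarrow> ram_config" where
  "reg_config p xs m = \<lparr>pc = p, regs = (\<lambda>i. if i < length xs then xs ! i else 0), mem = m\<rparr>"

lemma words_bounded_reg_config:
  "words_bounded B (reg_config p xs m) \<longleftrightarrow> (\<forall>x\<in>set xs. x \<le> B) \<and> (\<forall>a. m a \<le> B)"
  by (auto simp: words_bounded_def reg_config_def all_set_conv_all_nth)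

lemma ram_step_reg_config:
  "ram_step P (reg_config p xs m) =
     (if p < length P then exec_instr (P ! p) (reg_config p xs m) else reg_config p xs m)"
  by (simp add: ram_step_def reg_config_def)

lemma exec_instr_reg_config:
  "i < length xs \<Longrightarrow> exec_instr (Const i k) (reg_config p xs m) = reg_config (Suc p) (xs[i := k]) m"
  "\<lbrakk>i < length xs; j < length xs; k < length xs\<rbrakk> \<Longrightarrow>
     exec_instr (Add i j k) (reg_config p xs m) = reg_config (Suc p) (xs[i := xs ! j + xs ! k]) m"
  "\<lbrakk>i < length xs; j < length xs; k < length xs\<rbrakk> \<Longrightarrow>
     exec_instr (Sub i j k) (reg_config p xs m) = reg_config (Suc p) (xs[i := xs ! j - xs ! k]) m"
  "\<lbrakk>i < length xs; j < length xs\<rbrakk> \<Longrightarrow>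
     exec_instr (Load i j) (reg_config p xs m) = reg_config (Suc p) (xs[i := m (xs ! j)]) m"
  "exec_instr (Jump l) (reg_config p xs m) = reg_config l xs m"
  "i < length xs \<Longrightarrow>
     exec_instr (JumpIfZero i l) (reg_config p xs m) =
       reg_config (if xs ! i = 0 then l else Suc p) xs m"
  "exec_instr (Halt b) (reg_config p xs m) = reg_config p xs m"
  by (auto simp: reg_config_def fun_eq_iff nth_list_update)

text \<open>
  Register 1 counts the remaining vertices, registers 0 and 5 run through the two characteristic
  vectors at the end of the input, and registers 3 and 4 hold their partial sums.
\<close>

definition compare_sums :: "instr list" where
  "compare_sums =
    [Load 1 3, Const 2 1, Sub 5 0 1, Sub 0 5 1,
     JumpIfZero 1 13,
     Load 6 0, Add 3 3 6, Load 6 5, Add 4 4 6, Add 0 0 2, Add 5 5 2, Sub 1 1 2, Jump 4,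
     Sub 6 3 4, JumpIfZero 6 16, Halt False,
     Sub 6 4 3, JumpIfZero 6 19, Halt False,
     Halt True]"

lemmas run_simps = bounded_run_0 bounded_run_Suc bounded_run_numeral words_bounded_reg_config
  ram_step_reg_config exec_instr_reg_config

text \<open>Register 3 is still 0, so the first load fetches the number of vertices from cell 0. The
  two vectors are located by counting back from the end of the input, which avoids parsing the
  adjacency lists.\<close>

lemma compare_sums_init:
  assumes "\<And>a. m a \<le> l" "m 0 = n" "n + n < l"
  shows "bounded_run compare_sums l (reg_config 0 [l, 0, 0, 0, 0, 0, 0] m) 4
           (reg_config 4 [l - n - n, n, 1, 0, 0, l - n, 0] m)"
  using assms
  by (simp add: run_simps compare_sums_def del: exec_instr.simps, simp add: eval_nat_numeral)

lemma compare_sums_loop: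
  assumes "\<And>a. m a \<le> l" "a < l" "b < l" "k < l" "x + m a \<le> l" "y + m b \<le> l" "z \<le> l"
  shows "bounded_run compare_sums l (reg_config 4 [a, Suc k, 1, x, y, b, z] m) 9
           (reg_config 4 [Suc a, k, 1, x + m a, y + m b, Suc b, m b] m)"
  using assms by (simp add: run_simps compare_sums_def del: exec_instr.simps)

text \<open>Subtraction is truncated, so equality is tested by both differences being 0.\<close>

lemma compare_sums_exit:
  assumes "\<And>a. m a \<le> l" "a \<le> l" "b \<le> l" "0 < l" "x \<le> l" "y \<le> l" "z \<le> l"
  shows "\<exists>t s. t \<le> 5 \<and> bounded_run compare_sums l (reg_config 4 [a, 0, 1, x, y, b, z] m) t s \<and>
           ram_answers compare_sums s (x = y)"
proof -
  consider "x > y" | "x < y" | "x = y" by linarith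
  then show ?thesis
  proof cases
    case 1
    then have "bounded_run compare_sums l (reg_config 4 [a, 0, 1, x, y, b, z] m) 3
        (reg_config 15 [a, 0, 1, x, y, b, x - y] m)"
      using assms by (simp add: run_simps compare_sums_def del: exec_instr.simps)
    moreover have "ram_answers compare_sums (reg_config 15 [a, 0, 1, x, y, b, x - y] m) (x = y)"
      using 1 by (simp add: ram_answers_def reg_config_def compare_sums_def)
    moreover have "(3 :: nat) \<le> 5" by simp
    ultimately show ?thesis by blast
  next
    case 2
    then have "bounded_run compare_sums l (reg_config 4 [a, 0, 1, x, y, b, z] m) 5
        (reg_config 18 [a, 0, 1, x, y, b, y - x] m)"
      using assms by (simp add: run_simps compare_sums_def del: exec_instr.simps)
    moreover have "ram_answers compare_sums (reg_config 18 [a, 0, 1, x, y, b, y - x] m) (x = y)"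
      using 2 by (simp add: ram_answers_def reg_config_def compare_sums_def)
    moreover have "(5 :: nat) \<le> 5" by simp
    ultimately show ?thesis by blast
  next
    case 3
    then have "bounded_run compare_sums l (reg_config 4 [a, 0, 1, x, y, b, z] m) 5
        (reg_config 19 [a, 0, 1, x, y, b, 0] m)"
      using assms by (simp add: run_simps compare_sums_def del: exec_instr.simps)
    moreover have "ram_answers compare_sums (reg_config 19 [a, 0, 1, x, y, b, 0] m) (x = y)"
      using 3 by (simp add: ram_answers_def reg_config_def compare_sums_def)
    moreover have "(5 :: nat) \<le> 5" by simp
    ultimately show ?thesis by blast
  qed
qed

lemma sum_list_le_length:
  fixes xs :: "nat list"
  assumes "\<forall>x\<in>set xs. x \<le> 1"
  shows "sum_list xs \<le> length xs"
  using assms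
proof (induction xs)
  case (Cons x xs)
  then have "x \<le> 1" "sum_list xs \<le> length xs" by auto
  then show ?case by simp
qed simp

lemma compare_sums_correct:
  assumes w: "w = [n] @ us @ xs @ ys" and len: "length xs = n" "length ys = n"
    and us: "\<forall>u\<in>set us. u \<le> n"
    and bits: "\<forall>x\<in>set xs. x \<le> 1" "\<forall>y\<in>set ys. y \<le> 1"
  shows "\<exists>t \<le> 9 * length w.
     ram_answers compare_sums (ram_config_at compare_sums w t) (sum_list xs = sum_list ys) \<and>
     (\<forall>s\<le>t. words_bounded (length w) (ram_config_at compare_sums w s))"
proof -
  define l where "l = length w"
  define m where "m = (\<lambda>a. if a < length w then w ! a else 0)"
  define p where "p = Suc (length us)"
  have l: "l = p + n + n" "n + n < l" using w len by (auto simp: l_def p_def)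
  have "x \<le> l" if "x \<in> set w" for x
    using that us bits l(2) unfolding w by fastforce
  then have m: "m a \<le> l" for a by (simp add: m_def)
  have m0: "m 0 = n" by (simp add: m_def w)
  have mx: "m (p + i) = xs ! i" if "i < n" for i
    using that len by (simp add: m_def w p_def nth_append)
  have my: "m (p + n + i) = ys ! i" if "i < n" for i
    using that len by (simp add: m_def w p_def nth_append)
  have "sum_list (take i zs) \<le> n" if "length zs = n" "\<forall>z\<in>set zs. z \<le> 1" for i zs
    using sum_list_le_length[of "take i zs"] that by (fastforce dest: in_set_takeD)
  then have sums: "sum_list (take i xs) \<le> n" "sum_list (take i ys) \<le> n" for i
    using bits len by auto
  let ?init = "reg_config 0 [l, 0, 0, 0, 0, 0, 0] m"
  have init: "ram_init w = ?init"
    by (auto simp: ram_init_def reg_config_def l_def m_def fun_eq_iff nth_Cons split: nat.split)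
  \<comment> \<open>Loop invariant after \<open>i\<close> rounds of nine instructions. The witness
    \<open>z\<close> is whatever the scratch register 6 holds.\<close>
  have loop: "\<exists>z\<le>l. bounded_run compare_sums l ?init (4 + 9 * i)
      (reg_config 4 [p + i, n - i, 1, sum_list (take i xs), sum_list (take i ys), p + n + i, z] m)"
    if "i \<le> n" for i
    using that
  proof (induction i)
    case 0
    then show ?case using compare_sums_init[of m l n] m m0 l by auto
  next
    case (Suc i)
    then obtain z where z: "z \<le> l" "bounded_run compare_sums l ?init (4 + 9 * i)
      (reg_config 4 [p + i, n - i, 1, sum_list (take i xs), sum_list (take i ys), p + n + i, z] m)"
      by auto
    have i: "n - i = Suc (n - Suc i)" "i < n" using Suc.prems by auto
    have S: "sum_list (take (Suc i) xs) = sum_list (take i xs) + m (p + i)"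
      "sum_list (take (Suc i) ys) = sum_list (take i ys) + m (p + n + i)"
      using i len by (auto simp: take_Suc_conv_app_nth mx my)
    have "bounded_run compare_sums l
        (reg_config 4 [p + i, Suc (n - Suc i), 1, sum_list (take i xs), sum_list (take i ys),
           p + n + i, z] m) 9
        (reg_config 4 [Suc (p + i), n - Suc i, 1, sum_list (take i xs) + m (p + i),
           sum_list (take i ys) + m (p + n + i), Suc (p + n + i), m (p + n + i)] m)"
      using m i(2) z(1) l sums[of "Suc i"] unfolding S
      by (intro compare_sums_loop) auto
    from bounded_run_trans[OF z(2)[unfolded i(1)] this] show ?case
      using m[of "p + n + i"] unfolding S[symmetric] by (auto simp: algebra_simps)
  qed
  obtain z where z: "z \<le> l" "bounded_run compare_sums l ?init (4 + 9 * n)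
      (reg_config 4 [p + n, 0, 1, sum_list xs, sum_list ys, p + n + n, z] m)"
    using loop[of n] len by auto
  obtain t s where t: "t \<le> 5" "ram_answers compare_sums s (sum_list xs = sum_list ys)"
    "bounded_run compare_sums l
      (reg_config 4 [p + n, 0, 1, sum_list xs, sum_list ys, p + n + n, z] m) t s"
    using compare_sums_exit[of m l "p + n" "p + n + n" "sum_list xs" "sum_list ys" z]
      m l z(1) sums[of n] len by auto
  have "bounded_run compare_sums l (ram_init w) (4 + 9 * n + t) s"
    unfolding init using z(2) t(3) by (rule bounded_run_trans)
  \<comment> \<open>Start and exit cost at most 4 + 5 = 9 steps, paid for by the length being at
    least \<open>2n + 1\<close>.\<close>
  moreover have "4 + 9 * n + t \<le> 9 * length w"
    using t(1) l by (auto simp: l_def)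
  ultimately show ?thesis
    using t(2) unfolding bounded_run_def ram_config_at_def l_def[symmetric] by blast
qed

text \<open>The adjacency lists become an opaque block \<open>us\<close>, of which only a bound on
  the entries is kept: indices are below \<open>n\<close>, and a list of distinct indices has length
  at most \<open>n\<close>. The bits sum to cardinalities because the enumeration is
  repetition-free.\<close>

lemma encodes_DrDSR_D:
  assumes "encodes_DrDSR (G, Ds, Dt) w" "Ds \<subseteq> pverts G" "Dt \<subseteq> pverts G"
  obtains n us xs ys where "w = [n] @ us @ xs @ ys" "length xs = n" "length ys = n"
    "\<forall>u\<in>set us. u \<le> n" "\<forall>x\<in>set xs. x \<le> 1" "\<forall>y\<in>set ys. y \<le> 1"
    "sum_list xs = card Ds" "sum_list ys = card Dt"
proof -
  obtain vs adj where vs: "distinct vs" "set vs = pverts G"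
    and adj: "\<And>i. i < length vs \<Longrightarrow> distinct (adj i) \<and>
        set (adj i) = {j. j < length vs \<and> (vs ! i, vs ! j) \<in> parcs G}"
    and w: "w = [length vs]
       @ concat (map (\<lambda>i. length (adj i) # adj i) [0..<length vs])
       @ map (\<lambda>v. of_bool (v \<in> Ds)) vs
       @ map (\<lambda>v. of_bool (v \<in> Dt)) vs"
    using assms(1) unfolding encodes_DrDSR_def by auto
  have card: "sum_list (map (\<lambda>v. of_bool (v \<in> D)) vs) = card D" if "D \<subseteq> pverts G" for D
    using that vs finite_set[of vs] by (simp add: sum_list_distinct_conv_sum_set of_bool_def sum.If_cases Int_absorb1)
  have "length (adj i) \<le> length vs" if "i < length vs" for i
  proof -
    have "length (adj i) = card (set (adj i))"
      using adj[OF that] distinct_card by metis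
    also have "\<dots> \<le> card {..<length vs}"
      using adj[OF that] by (intro card_mono) auto
    finally show ?thesis by simp
  qed
  moreover have "j \<le> length vs" if "i < length vs" "j \<in> set (adj i)" for i j
    using adj[OF that(1)] that(2) by auto
  ultimately show thesis
    using card assms(2,3) by (intro that[OF w]) auto
qed

theorem theorem17:
  fixes r :: nat
  assumes "r \<ge> 2"
  shows "solvable_in_linear_time encodes_DrDSR
           (DrDSR_tree_instances r :: 'a DrDSR_instance set) (DrDSR_TJ r)"
  unfolding solvable_in_linear_time_def
\<comment> \<open>With \<open>d = 1\<close> the word bound is the input length itself, as proved in
  \<open>compare_sums_correct\<close>.\<close>
proof (rule exI[of _ compare_sums], rule exI[of _ 9], rule exI[of _ 1], intro ballI allI impI)
  fix x :: "'a DrDSR_instance" and w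
  assume x: "x \<in> DrDSR_tree_instances r" and enc: "encodes_DrDSR x w"
  obtain G Ds Dt where xeq: "x = (G, Ds, Dt)" by (cases x)
  have "Ds \<subseteq> pverts G" "Dt \<subseteq> pverts G"
    using x by (auto simp: xeq DrDSR_tree_instances_def distance_dominating_set_def)
  then obtain n us xs ys where "w = [n] @ us @ xs @ ys" "length xs = n" "length ys = n"
    "\<forall>u\<in>set us. u \<le> n" "\<forall>x\<in>set xs. x \<le> 1" "\<forall>y\<in>set ys. y \<le> 1"
    and card: "sum_list xs = card Ds" "sum_list ys = card Dt"
    using encodes_DrDSR_D[OF enc[unfolded xeq]] by blast
  from compare_sums_correct[OF this(1-6)]
  show "\<exists>t\<le>9 * length w. ram_answers compare_sums (ram_config_at compare_sums w t) (DrDSR_TJ r x) \<and>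
      (\<forall>s\<le>t. words_bounded (1 * length w ^ 1) (ram_config_at compare_sums w s))"
    using DrDSR_TJ_tree_iff[OF x[unfolded xeq]] by (simp add: xeq card)
qed

end
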